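(* Let $\Lambda\subset[0,\infty)$ be an unbounded, infinite discrete set. If $\Lambda$ is $\mathbf{1}$-type $2$ (that is, $\mathbf{c}$-type $2$ with respect to the constant sequence $c_n\equiv 1$), then $\Lambda$ is $\mathbf{c}$-type $2$ with respect to every sequence $\mathbf{c}=(c_n)_{n=1}^\infty$ of positive real numbers.
   Context: "Discrete" means that $\Lambda$ has only finitely many elements in each bounded interval; write $\Lambda=\{\lambda_1,\lambda_2,\dots\}$ with $\lambda_1<\lambda_2<\dots$ and $\lambda_n\to\infty$. For a sequence $\mathbf{c}=(c_n)_{n=1}^\infty$ of positive real numbers, $\Lambda$ is called $\mathbf{c}$-type $2$ if there exists a measurable function $f:\mathbb{R}\to[0,+\infty)$ such that the series $s_{\mathbf{c},f}(x)=\sum_{n=1}^\infty c_n f(x+\lambda_n)$ does not converge for Lebesgue almost every $x\in\mathbb{R}$ and does not diverge for Lebesgue almost every $x\in\mathbb{R}$ either; equivalently, both $\{x: s_{\mathbf{c},f}(x)<\infty\}$ and $\{x: s_{\mathbf{c},f}(x)=\infty\}$ have positive Lebesgue measure. *)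

theory Defs
  imports "HOL-Analysis.Analysis"
begin

definition discrete_set :: "real set \<Rightarrow> bool" where
  "discrete_set \<Lambda> \<longleftrightarrow> (\<forall>a b. finite (\<Lambda> \<inter> {a..b}))"

(* Sequences are indexed from 0: incr_enum \<Lambda> n is \<lambda>_{n+1}, and c n below is c_{n+1}.
   The library's enumerate is only available for well-ordered types, hence not for real sets.
   The description denotes properly by strict_mono_enum_ex1. *)
definition incr_enum :: "real set \<Rightarrow> nat \<Rightarrow> real" where
  "incr_enum \<Lambda> = (THE l. strict_mono l \<and> range l = \<Lambda>)"

(* The terms of the series are nonnegative, so that failure of summability is
   divergence to infinity. Measurable means Lebesgue measurable. *)
definition c_type2 :: "(nat \<Rightarrow> real) \<Rightarrow> real set \<Rightarrow> bool" where
  "c_type2 c \<Lambda> \<longleftrightarrow>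
     (\<exists>f :: real \<Rightarrow> real.
        f \<in> borel_measurable lebesgue \<and> (\<forall>x. 0 \<le> f x) \<and>
        \<not> (AE x in lebesgue. summable (\<lambda>n. c n * f (x + incr_enum \<Lambda> n))) \<and>
        \<not> (AE x in lebesgue. \<not> summable (\<lambda>n. c n * f (x + incr_enum \<Lambda> n))))"

lemma strict_mono_range_unique:
  fixes l m :: "nat \<Rightarrow> real"
  assumes l: "strict_mono l" and m: "strict_mono m" and r: "range l = range m"
  shows "l = m"
proof -
  have rank: "card {y \<in> range k. y < k n} = n" if "strict_mono k" for k :: "nat \<Rightarrow> real" and n
  proof -
    have "{y \<in> range k. y < k n} = k ` {..<n}"
      using strict_mono_less[OF that] by auto
    moreover have "inj_on k {..<n}"
      by (intro inj_onI) (simp add: strict_mono_eq[OF that])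
    ultimately show ?thesis by (simp add: card_image)
  qed
  show ?thesis
  proof
    fix n
    have "l n \<in> range m" using r by auto
    then obtain k where k: "l n = m k" by auto
    have "n = card {y \<in> range l. y < l n}" using rank[OF l] by simp
    also have "\<dots> = k" using rank[OF m, of k] by (simp add: r k)
    finally show "l n = m n" using k by simp
  qed
qed

lemma strict_mono_enum_ex1:
  assumes nonneg: "\<Lambda> \<subseteq> {0..}" and inf: "infinite \<Lambda>" and disc: "discrete_set \<Lambda>"
  shows "\<exists>!l :: nat \<Rightarrow> real. strict_mono l \<and> range l = \<Lambda>"
proof -
  define g where "g x = card {y \<in> \<Lambda>. y < x}" for x
  have fin: "finite {y \<in> \<Lambda>. y < x}" for x
    by (rule finite_subset[of _ "\<Lambda> \<inter> {0..x}"])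
       (use nonneg disc in \<open>auto simp: discrete_set_def\<close>)
  have g_less: "g x < g y" if "x \<in> \<Lambda>" "x < y" for x y
    unfolding g_def by (rule psubset_card_mono[OF fin]) (use that in auto)
  have inj: "inj_on g \<Lambda>"
    by (rule inj_onI) (metis g_less less_irrefl linorder_neqE)
  have down: "k \<in> g ` \<Lambda>" if "x \<in> \<Lambda>" "k \<le> g x" for k x
  proof -
    have "g ` {y \<in> \<Lambda>. y < x} = {..<g x}"
    proof (rule card_subset_eq)
      show "g ` {y \<in> \<Lambda>. y < x} \<subseteq> {..<g x}" using g_less by auto
      have "card (g ` {y \<in> \<Lambda>. y < x}) = card {y \<in> \<Lambda>. y < x}"
        by (rule card_image, rule inj_on_subset[OF inj]) auto
      then show "card (g ` {y \<in> \<Lambda>. y < x}) = card {..<g x}" by (simp add: g_def)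
    qed simp
    then show ?thesis using that by (cases "k = g x") auto
  qed
  have "infinite (g ` \<Lambda>)" using inf inj by (simp add: finite_image_iff)
  then have surj: "k \<in> g ` \<Lambda>" for k
    using down by (metis (no_types, lifting) image_iff infinite_nat_iff_unbounded_le)
  define l where "l = inv_into \<Lambda> g"
  have l_in: "l k \<in> \<Lambda>" and g_l: "g (l k) = k" for k
    unfolding l_def using surj by (auto intro: inv_into_into f_inv_into_f)
  have "strict_mono l"
    by (rule strict_monoI) (metis g_l g_less l_in less_asym linorder_neqE)
  moreover have "range l = \<Lambda>"
    using l_in inv_into_f_f[OF inj] unfolding l_def by (auto intro: rangeI) (metis rangeI)
  ultimately have l: "strict_mono l \<and> range l = \<Lambda>" by simp
  show ?thesis
  proof (rule ex1I)
    show "strict_mono l \<and> range l = \<Lambda>" by (rule l)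
  next
    fix m :: "nat \<Rightarrow> real" assume "strict_mono m \<and> range m = \<Lambda>"
    then show "m = l" using l strict_mono_range_unique[of m l] by simp
  qed
qed

end

theory Submission
  imports Defs "HOL-Probability.Probability"
begin

text \<open>
  A witness \<open>f\<close> can be replaced by the indicator of a random set. Cut the line into cells so fine that,
  for each \<open>x\<close>, the points \<open>x + \<lambda>\<^sub>n\<close> with \<open>n\<close> large lie in distinct cells. Draw for every cell an
  independent uniform threshold in \<open>[0, 1]\<close> and let \<open>U\<close> consist of the points where \<open>f\<close> exceeds the
  threshold of its cell. By the two Borel-Cantelli lemmas and Fubini, almost surely for almost every \<open>x\<close>
  only finitely many \<open>x + \<lambda>\<^sub>n\<close> hit \<open>U\<close> if and only if \<open>\<Sum>f(x + \<lambda>\<^sub>n)\<close> converges. On \<open>U\<close> one may then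
  put a weight \<open>W\<close> growing fast enough that \<open>c\<^sub>n W(x + \<lambda>\<^sub>n) \<ge> 1\<close> for large \<open>n\<close>: finitely many
  nonzero terms still converge, and infinitely many terms of size at least 1 diverge.
\<close>

section \<open>Series and products of numbers in the unit interval\<close>

text \<open>Terms of a convergent series tend to 0, so truncation at 1 alters only finitely many of
  them. This allows the values of the witness to be used as probabilities.\<close>

lemma summable_min_one_iff:
  fixes a :: "nat \<Rightarrow> real"
  assumes "\<And>n. 0 \<le> a n"
  shows "summable (\<lambda>n. min 1 (a n)) \<longleftrightarrow> summable a"
proof
  assume "summable (\<lambda>n. min 1 (a n))"
  then have "\<forall>\<^sub>F n in sequentially. min 1 (a n) < 1"
    by (intro order_tendstoD(2)[OF summable_LIMSEQ_zero]) auto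
  then have "\<forall>\<^sub>F n in sequentially. a n = min 1 (a n)"
    by eventually_elim auto
  with \<open>summable (\<lambda>n. min 1 (a n))\<close> show "summable a"
    by (simp only: summable_cong)
next
  assume "summable a"
  then show "summable (\<lambda>n. min 1 (a n))"
    by (rule summable_comparison_test[rotated]) (use assms in auto)
qed

text \<open>Since \<open>1 - t \<le> exp (- t)\<close>, the products are dominated by
  \<open>exp\<close> of minus the unbounded partial sums. This is the analytic core of the second
  Borel-Cantelli lemma.\<close>

lemma not_summable_prod_tendsto_0:
  fixes a :: "nat \<Rightarrow> real"
  assumes a: "\<And>n. 0 \<le> a n" "\<And>n. a n \<le> 1" and div: "\<not> summable a"
  shows "(\<lambda>K. \<Prod>n<K. 1 - a n) \<longlonglongrightarrow> 0"
proof (rule tendsto_sandwich[OF _ _ tendsto_const])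
  show "\<forall>\<^sub>F K in sequentially. 0 \<le> (\<Prod>n<K. 1 - a n)"
    by (intro always_eventually allI prod_nonneg) (simp add: a)
  have "(\<Prod>n<K. 1 - a n) \<le> exp (- (\<Sum>n<K. a n))" for K
  proof -
    have "(\<Prod>n<K. 1 - a n) \<le> (\<Prod>n<K. exp (- a n))"
      using exp_ge_add_one_self[of "- a _"] by (intro prod_mono) (simp add: a)
    then show ?thesis by (simp add: exp_sum flip: sum_negf)
  qed
  then show "\<forall>\<^sub>F K in sequentially. (\<Prod>n<K. 1 - a n) \<le> exp (- (\<Sum>n<K. a n))" by simp
  have "filterlim (\<lambda>K. \<Sum>n<K. a n) at_top sequentially"
    unfolding filterlim_at_top
  proof
    fix Z
    obtain K where K: "Z < (\<Sum>n<K. a n)"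
      using div summableI_nonneg_bounded[of a Z] a(1) by (meson not_less)
    have "Z \<le> (\<Sum>n<K'. a n)" if "K \<le> K'" for K'
      using K sum_mono2[of "{..<K'}" "{..<K}" a] a(1) that by force
    then show "\<forall>\<^sub>F K' in sequentially. Z \<le> (\<Sum>n<K'. a n)"
      by (auto simp: eventually_sequentially)
  qed
  then show "(\<lambda>K. exp (- (\<Sum>n<K. a n))) \<longlonglongrightarrow> 0"
    by (intro filterlim_compose[OF exp_at_bot] filterlim_compose[OF filterlim_uminus_at_bot_at_top])
qed

section \<open>Independent uniform thresholds and the Borel-Cantelli lemmas\<close>

definition thresholds :: "('i \<Rightarrow> real) measure" where
  "thresholds = PiM UNIV (\<lambda>_. uniform_measure lborel {0..1})"

lemma prob_space_unit_interval: "prob_space (uniform_measure lborel {0..1::real})"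
  by (intro prob_space_uniform_measure) auto

interpretation unit_interval: product_prob_space "\<lambda>_. uniform_measure lborel {0..1::real}" I for I
  by (rule product_prob_spaceI) (rule prob_space_unit_interval)

lemma prob_space_thresholds: "prob_space thresholds"
  unfolding thresholds_def by (rule prob_space_PiM) (rule prob_space_unit_interval)

lemma measurable_thresholds_component [measurable]:
  "(\<lambda>\<theta>. \<theta> i) \<in> borel_measurable thresholds"
  unfolding thresholds_def
  by (rule measurable_compose[OF measurable_component_singleton[of i UNIV]]) (auto simp: measurable_def)

lemma space_thresholds [simp]: "space thresholds = UNIV"
  by (simp add: thresholds_def space_PiM)

lemma emeasure_threshold_less:
  assumes "0 \<le> a" "a \<le> 1"
  shows "emeasure thresholds {\<theta>. \<theta> i < a} = ennreal a"
proof -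
  have "{0..1} \<inter> {..<a} = {0..<a}" using assms by auto
  then show ?thesis
    using unit_interval.emeasure_PiM_Collect_single[of i UNIV "{..<a}"] divide_ennreal[of a 1] assms
    by (simp add: thresholds_def space_PiM)
qed

lemma emeasure_thresholds_ge:
  assumes "finite J" "\<And>i. i \<in> J \<Longrightarrow> 0 \<le> a i" "\<And>i. i \<in> J \<Longrightarrow> a i \<le> 1"
  shows "emeasure thresholds {\<theta>. \<forall>i\<in>J. a i \<le> \<theta> i} = ennreal (\<Prod>i\<in>J. 1 - a i)"
proof -
  have *: "emeasure (uniform_measure lborel {0..1}) {a i..} = ennreal (1 - a i)" if "i \<in> J" for i
  proof -
    have "{0..1} \<inter> {a i..} = {a i..1}" using assms(2)[OF that] by auto
    then show ?thesis using divide_ennreal[of "1 - a i" 1] assms that by simp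
  qed
  show ?thesis
    using unit_interval.emeasure_PiM_Collect[of J UNIV "\<lambda>i. {a i..}"] assms *
    by (simp add: thresholds_def space_PiM prod_ennreal)
qed

text \<open>The event \<open>\<theta> (j n) < a n\<close> has probability \<open>a n\<close>.
  Convergence is the first Borel-Cantelli lemma. For divergence, injectivity of \<open>j\<close>
  from \<open>N\<close> on makes these events independent there, as they look at different
  coordinates.\<close>

lemma AE_thresholds_finite_iff_summable:
  fixes a :: "nat \<Rightarrow> real" and j :: "nat \<Rightarrow> 'i"
  assumes a: "\<And>n. 0 \<le> a n" "\<And>n. a n \<le> 1" and j: "inj_on j {N..}"
  shows "AE \<theta> in thresholds. finite {n. \<theta> (j n) < a n} \<longleftrightarrow> summable a"
proof (cases "summable a")
  case True
  have "AE \<theta> in thresholds. \<forall>\<^sub>F n in sequentially. \<theta> \<in> space thresholds - {\<theta>. \<theta> (j n) < a n}"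
  proof (rule borel_cantelli_AE1)
    show "summable (\<lambda>n. measure thresholds {\<theta>. \<theta> (j n) < a n})"
      using True by (simp add: measure_def emeasure_threshold_less a)
    show "{\<theta>. \<theta> (j n) < a n} \<in> sets thresholds" for n
    proof -
      have "{\<theta> \<in> space thresholds. \<theta> (j n) < a n} \<in> sets thresholds" by measurable
      then show ?thesis by simp
    qed
  qed (simp add: emeasure_threshold_less a)
  then show ?thesis
  proof eventually_elim
    case (elim \<theta>)
    then show ?case using True
      by (simp add: not_less[symmetric] flip: cofinite_eq_sequentially) (simp add: eventually_cofinite)
  qed
next
  case False
  have "AE \<theta> in thresholds. \<exists>n\<ge>m. \<theta> (j n) < a n" if m: "m \<ge> N" for m
  proof (rule AE_I)
    \<comment> \<open>\<open>?B'\<close> says that no event occurs from \<open>m\<close> on. It lies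
      in every \<open>?B K\<close>, whose probability is a finite product tending to 0 as
      \<open>K\<close> grows.\<close>
    let ?B = "\<lambda>K. {\<theta> :: 'i \<Rightarrow> real. \<forall>n\<in>{..<K}. a (n + m) \<le> \<theta> (j (n + m))}"
    let ?B' = "{\<theta> :: 'i \<Rightarrow> real. \<forall>n\<ge>m. a n \<le> \<theta> (j n)}"
    show "{\<theta> \<in> space thresholds. \<not> (\<exists>n\<ge>m. \<theta> (j n) < a n)} \<subseteq> ?B'"
      by (auto simp: not_less)
    have "{\<theta> \<in> space thresholds. \<forall>n\<ge>m. a n \<le> \<theta> (j n)} \<in> sets (thresholds :: ('i \<Rightarrow> real) measure)"
      by measurable
    then show "?B' \<in> sets thresholds" by simp
    have B: "emeasure thresholds (?B K) = ennreal (\<Prod>n<K. 1 - a (n + m))" for K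
    proof -
      let ?i = "\<lambda>n. j (n + m)"
      have inj: "inj_on ?i {..<K}"
        using m by (auto intro!: inj_onI dest!: inj_onD[OF j])
      have inv: "the_inv_into {..<K} ?i (?i n) = n" if "n < K" for n
        using the_inv_into_f_f[OF inj, of n] that by simp
      \<comment> \<open>The product formula is indexed by coordinates, so the bounds are carried
        from \<open>n\<close> to the coordinate \<open>j (n + m)\<close>.\<close>
      have "?B K = {\<theta>. \<forall>i\<in>?i ` {..<K}. a (the_inv_into {..<K} ?i i + m) \<le> \<theta> i}"
        using inv by auto
      also have "emeasure thresholds \<dots> = ennreal (\<Prod>i\<in>?i ` {..<K}. 1 - a (the_inv_into {..<K} ?i i + m))"
        by (rule emeasure_thresholds_ge) (auto simp: a)
      also have "\<dots> = ennreal (\<Prod>n<K. 1 - a (n + m))"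
        by (simp add: prod.reindex[OF inj] inv)
      finally show ?thesis .
    qed
    have "(\<lambda>K. ennreal (\<Prod>n<K. 1 - a (n + m))) \<longlonglongrightarrow> ennreal 0"
      using False by (intro tendsto_ennrealI not_summable_prod_tendsto_0) (auto simp: a summable_iff_shift)
    moreover have "emeasure thresholds ?B' \<le> ennreal (\<Prod>n<K. 1 - a (n + m))" for K
    proof -
      have "{\<theta> \<in> space thresholds. \<forall>n\<in>{..<K}. a (n + m) \<le> \<theta> (j (n + m))} \<in> sets (thresholds :: ('i \<Rightarrow> real) measure)"
        by measurable
      then show ?thesis unfolding B[symmetric] by (intro emeasure_mono) auto
    qed
    ultimately have "emeasure thresholds ?B' \<le> ennreal 0"
      by (intro LIMSEQ_le_const) auto
    then show "emeasure thresholds ?B' = 0" by simp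
  qed
  then have "AE \<theta> in thresholds. \<forall>m. m \<ge> N \<longrightarrow> (\<exists>n\<ge>m. \<theta> (j n) < a n)"
    by (subst AE_all_countable) auto
  then show ?thesis
  proof eventually_elim
    case (elim \<theta>)
    have "\<exists>n\<ge>m. n \<in> {n. \<theta> (j n) < a n}" for m
      using elim[rule_format, of "max m N"] by auto
    then have "infinite {n. \<theta> (j n) < a n}" unfolding infinite_nat_iff_unbounded_le by blast
    then show ?case using False by simp
  qed
qed

section \<open>Cells and the random set\<close>

text \<open>Each unit interval \<open>[k, k + 1)\<close> gets its own mesh \<open>1 / N k\<close>,
  finer than all gaps between points of the sequence that matter there.\<close>

lemma ex_separating_grid:
  fixes l :: "nat \<Rightarrow> real"
  assumes l: "strict_mono l" and fin: "\<And>b. finite {n. l n \<le> b}"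
  obtains q :: "real \<Rightarrow> int \<times> int"
  where "q \<in> borel \<rightarrow>\<^sub>M count_space UNIV" "\<And>x. \<exists>N. inj_on (\<lambda>n. q (x + l n)) {N..}"
proof -
  \<comment> \<open>If \<open>- 2 * x < l m\<close> and \<open>x + l m < k + 1\<close>, then
    \<open>l m = 2 * (x + l m) - (2 * x + l m) < 2 * (k + 1)\<close>. So finitely many
    \<open>m\<close>, chosen independently of \<open>x\<close>, have to be separated from their
    predecessors.\<close>
  have "\<exists>N::nat. \<forall>m\<in>{m. l m \<le> 2 * (of_int k + 1)}. \<forall>n\<in>{..<m}. 1 < (l m - l n) * real N" for k :: int
  proof (rule eventually_happens'[OF sequentially_bot], intro eventually_ball_finite fin ballI)
    fix m n :: nat assume "n \<in> {..<m}"
    then have "0 < l m - l n" using strict_monoD[OF l] by simp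
    moreover have "\<forall>\<^sub>F N in sequentially. 1 / (l m - l n) < real N"
      using filterlim_real_sequentially unfolding filterlim_at_top_dense by blast
    ultimately show "\<forall>\<^sub>F N in sequentially. 1 < (l m - l n) * real N"
      by (simp add: field_simps)
  qed auto
  then obtain N :: "int \<Rightarrow> nat" where
    N: "\<And>k m n. l m \<le> 2 * (of_int k + 1) \<Longrightarrow> n < m \<Longrightarrow> 1 < (l m - l n) * real (N k)"
    by (metis (no_types, lifting) lessThan_iff mem_Collect_eq)
  define q where "q y = (\<lfloor>y\<rfloor>, \<lfloor>y * real (N \<lfloor>y\<rfloor>)\<rfloor>)" for y :: real
  show ?thesis
  proof
    have "(\<lambda>y. (\<lambda>k y. (k, \<lfloor>y * real (N k)\<rfloor>)) \<lfloor>y\<rfloor> y) \<in> borel \<rightarrow>\<^sub>M count_space UNIV"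
      by (rule measurable_compose_countable) measurable
    then show "q \<in> borel \<rightarrow>\<^sub>M count_space UNIV" by (simp add: q_def[abs_def])
  next
    fix x :: real
    obtain M where M: "\<And>n. l n \<le> - 2 * x \<Longrightarrow> n < M"
      using fin[of "- 2 * x"] by (auto simp: finite_nat_iff_bounded)
    have "q (x + l n) \<noteq> q (x + l m)" if "n < m" "M \<le> m" for n m
    proof
      assume eq: "q (x + l n) = q (x + l m)"
      define k where "k = \<lfloor>x + l m\<rfloor>"
      have "l m > - 2 * x" using M[of m] that by force
      moreover have "x + l m < of_int k + 1" by (simp add: k_def)
      ultimately have "1 < (l m - l n) * real (N k)"
        using that by (intro N) auto
      \<comment> \<open>Equal floors force the scaled points to be less than 1 apart, against the
        choice of \<open>N k\<close>.\<close>
      moreover have "\<lfloor>(x + l n) * real (N k)\<rfloor> = \<lfloor>(x + l m) * real (N k)\<rfloor>"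
        using eq unfolding q_def k_def by (metis prod.inject)
      then have "(x + l m) * real (N k) - (x + l n) * real (N k) < 1"
        by linarith
      ultimately show False by (simp add: algebra_simps)
    qed
    then have "inj_on (\<lambda>n. q (x + l n)) {M..}"
      by (intro linorder_inj_onI) auto
    then show "\<exists>N. inj_on (\<lambda>n. q (x + l n)) {N..}" ..
  qed
qed

text \<open>For every \<open>x\<close> almost every \<open>\<theta>\<close> is good. Fubini turns
  this around: almost every \<open>\<theta>\<close> is good for almost every \<open>x\<close>, and
  one such \<open>\<theta>\<close> defines \<open>U\<close>.\<close>

lemma ex_set_finite_hits_iff_summable:
  fixes l :: "nat \<Rightarrow> real" and f :: "real \<Rightarrow> real"
  assumes l: "strict_mono l" "\<And>b. finite {n. l n \<le> b}"
    and f [measurable]: "f \<in> borel_measurable borel" and f01: "\<And>x. 0 \<le> f x" "\<And>x. f x \<le> 1"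
  obtains U where "U \<in> sets borel"
    "AE x in lborel. finite {n. x + l n \<in> U} \<longleftrightarrow> summable (\<lambda>n. f (x + l n))"
proof -
  obtain q :: "real \<Rightarrow> int \<times> int" where q [measurable]: "q \<in> borel \<rightarrow>\<^sub>M count_space UNIV"
    and inj: "\<And>x. \<exists>N. inj_on (\<lambda>n. q (x + l n)) {N..}"
    using ex_separating_grid[OF l] by metis
  interpret T: prob_space "thresholds :: (int \<times> int \<Rightarrow> real) measure" by (rule prob_space_thresholds)
  interpret pair_sigma_finite lborel "thresholds :: (int \<times> int \<Rightarrow> real) measure" ..
  let ?P = "\<lambda>x \<theta>. finite {n. \<theta> (q (x + l n)) < f (x + l n)} \<longleftrightarrow> summable (\<lambda>n. f (x + l n))"
  \<comment> \<open>The coordinate that is read depends on \<open>x\<close>; there are only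
    countably many cells, so evaluation stays jointly measurable.\<close>
  have [measurable]: "(\<lambda>p. snd p (q (fst p + l n))) \<in> borel_measurable (lborel \<Otimes>\<^sub>M thresholds)" for n
    by (rule measurable_compose_countable[of "\<lambda>i p. snd p i"]) measurable
  \<comment> \<open>Fubini needs joint measurability of \<open>?P\<close>. This form uses only
    countable quantifiers and an extended nonnegative sum.\<close>
  have eq: "?P x \<theta> \<longleftrightarrow> ((\<exists>m. \<forall>n>m. \<not> \<theta> (q (x + l n)) < f (x + l n)) \<longleftrightarrow> (\<Sum>n. ennreal (f (x + l n))) < \<infinity>)"
    for x \<theta>
  proof -
    have "summable (\<lambda>n. f (x + l n)) \<longleftrightarrow> (\<Sum>n. ennreal (f (x + l n))) < \<infinity>"
      using f01 by (auto simp: less_top suminf_ennreal2 intro: summable_suminf_not_top)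
    moreover have "finite {n. \<theta> (q (x + l n)) < f (x + l n)}
        \<longleftrightarrow> (\<exists>m. \<forall>n>m. \<not> \<theta> (q (x + l n)) < f (x + l n))"
      using infinite_nat_iff_unbounded[of "{n. \<theta> (q (x + l n)) < f (x + l n)}"] by auto
    ultimately show ?thesis by simp
  qed
  have "AE x in lborel. AE \<theta> in thresholds. ?P x \<theta>"
  proof (rule AE_I2)
    fix x
    obtain N where "inj_on (\<lambda>n. q (x + l n)) {N..}" using inj by blast
    then show "AE \<theta> in thresholds. ?P x \<theta>"
      by (rule AE_thresholds_finite_iff_summable[rotated 2]) (rule f01)+
  qed
  moreover have "{p \<in> space (lborel \<Otimes>\<^sub>M thresholds). ?P (fst p) (snd p)} \<in> sets (lborel \<Otimes>\<^sub>M thresholds)"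
    unfolding eq by measurable
  ultimately have ae: "AE \<theta> in thresholds. AE x in lborel. ?P x \<theta>"
    by (subst (asm) AE_commute) auto
  \<comment> \<open>A property that holds almost surely in a probability space has a
    witness.\<close>
  have "\<exists>\<theta>. AE x in lborel. ?P x \<theta>"
  proof (rule ccontr)
    assume none: "\<not> ?thesis"
    have "AE \<theta> in thresholds :: (int \<times> int \<Rightarrow> real) measure. False"
      using ae by (rule eventually_mono) (use none in blast)
    then show False by simp
  qed
  then obtain \<theta> where \<theta>: "AE x in lborel. ?P x \<theta>" ..
  show ?thesis
  proof
    have [measurable]: "(\<lambda>y. \<theta> (q y)) \<in> borel_measurable borel"
      by (rule measurable_compose[OF q]) simp
    have "{y \<in> space borel. \<theta> (q y) < f y} \<in> sets borel" by measurable
    then show "{y. \<theta> (q y) < f y} \<in> sets borel" by simp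
    show "AE x in lborel. finite {n. x + l n \<in> {y. \<theta> (q y) < f y}} \<longleftrightarrow> summable (\<lambda>n. f (x + l n))"
      using \<theta> by simp
  qed
qed

section \<open>Weights on the random set\<close>

lemma AE_lborel_translate:
  fixes P :: "real \<Rightarrow> bool"
  assumes "AE x in lborel. P x"
  shows "AE x in lborel. P (x + t)"
proof -
  obtain N where N: "N \<in> null_sets lborel" "{x. \<not> P x} \<subseteq> N"
    using assms by (auto simp: eventually_ae_filter)
  have [measurable]: "N \<in> sets borel" using N by auto
  have "AE x in lborel. x \<notin> N" using N by (rule_tac AE_not_in)
  then have "AE x in lborel. t + 1 * x \<notin> N"
    by (intro AE_borel_affine) auto
  then show ?thesis
    by eventually_elim (use N(2) in \<open>auto simp: add.commute\<close>)
qed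

text \<open>Agreement off a null set transfers both defining conditions of type 2 from
  \<open>f\<close> to \<open>g\<close>.\<close>

lemma ex_weighted_AE_summable_iff:
  fixes l c :: "nat \<Rightarrow> real" and f :: "real \<Rightarrow> real"
  assumes l: "strict_mono l" and fin: "\<And>b. finite {n. l n \<le> b}" and c: "\<And>n. 0 < c n"
    and f: "f \<in> borel_measurable lebesgue" and f0: "\<And>x. 0 \<le> f x"
  obtains g where "g \<in> borel_measurable lebesgue" "\<And>x. 0 \<le> g x"
    "AE x in lebesgue. summable (\<lambda>n. c n * g (x + l n)) \<longleftrightarrow> summable (\<lambda>n. f (x + l n))"
proof -
  obtain f' where f' [measurable]: "f' \<in> borel_measurable lborel" and ff': "AE x in lborel. f x = f' x"
    using completion_ex_borel_measurable_real[OF f] by blast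
  \<comment> \<open>The Borel representative \<open>f'\<close> may be negative on a null set, hence
    the \<open>max 0\<close>.\<close>
  define h where "h x = min 1 (max 0 (f' x))" for x
  obtain U where U [measurable]: "U \<in> sets borel"
    and hits: "AE x in lborel. finite {n. x + l n \<in> U} \<longleftrightarrow> summable (\<lambda>n. h (x + l n))"
  proof (rule ex_set_finite_hits_iff_summable[OF l fin])
    have "h \<in> borel_measurable lborel" unfolding h_def by measurable
    then show "h \<in> borel_measurable borel" by simp
  qed (auto simp: h_def)
  \<comment> \<open>With \<open>y = x + l n\<close>, the bound \<open>l n \<le> 2 * y\<close> says \<open>- 2 * x \<le> l n\<close>, so it holds for large \<open>n\<close>.\<close>
  define W where "W y = (\<Sum>n | l n \<le> 2 * y. 1 / c n)" for y
  have W0: "0 \<le> W y" for y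
    unfolding W_def by (intro sum_nonneg) (simp add: less_imp_le[OF c])
  have [measurable]: "W \<in> borel_measurable borel"
  proof (rule borel_measurable_mono, rule monoI)
    fix x y :: real assume "x \<le> y"
    then show "W x \<le> W y" unfolding W_def
      by (intro sum_mono2 fin) (auto simp: less_imp_le[OF c])
  qed
  define g where "g y = indicator U y * W y" for y
  have g: "summable (\<lambda>n. c n * g (x + l n)) \<longleftrightarrow> finite {n. x + l n \<in> U}" for x
  proof
    assume "summable (\<lambda>n. c n * g (x + l n))"
    then have "\<forall>\<^sub>F n in sequentially. c n * g (x + l n) < 1"
      by (intro order_tendstoD(2)[OF summable_LIMSEQ_zero]) auto
    moreover have "\<forall>\<^sub>F n in sequentially. \<not> l n \<le> - 2 * x"
      using fin[of "- 2 * x"] by (simp add: eventually_cofinite flip: cofinite_eq_sequentially)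
    ultimately have "\<forall>\<^sub>F n in sequentially. x + l n \<notin> U"
    proof eventually_elim
      case (elim n)
      \<comment> \<open>For such \<open>n\<close> the number \<open>1 / c n\<close> is itself a
        summand of \<open>W (x + l n)\<close>.\<close>
      have "1 / c n \<le> W (x + l n)" unfolding W_def
        using elim by (intro member_le_sum fin) (auto simp: less_imp_le[OF c])
      then have "1 \<le> c n * W (x + l n)" using c[of n] by (simp add: field_simps)
      then show ?case using elim(1) by (auto simp: g_def)
    qed
    then show "finite {n. x + l n \<in> U}"
      by (simp add: eventually_cofinite flip: cofinite_eq_sequentially)
  next
    assume "finite {n. x + l n \<in> U}"
    then show "summable (\<lambda>n. c n * g (x + l n))"
      by (rule summable_finite) (simp add: g_def)
  qed
  \<comment> \<open>The exceptional sets of the countably many translates together still form a null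
    set.\<close>
  have "AE x in lborel. \<forall>n. f (x + l n) = f' (x + l n)"
    using AE_lborel_translate[OF ff'] by (simp add: AE_all_countable)
  with hits have "AE x in lborel. summable (\<lambda>n. c n * g (x + l n)) \<longleftrightarrow> summable (\<lambda>n. f (x + l n))"
  proof eventually_elim
    case (elim x)
    then have "h (x + l n) = min 1 (f (x + l n))" for n
      using f0[of "x + l n"] by (simp add: h_def)
    then show ?case
      using elim(1) summable_min_one_iff[of "\<lambda>n. f (x + l n)"] by (simp only: g f0)
  qed
  moreover have "g \<in> borel_measurable borel" unfolding g_def by measurable
  ultimately show ?thesis
    by (intro that[of g]) (auto simp: AE_completion_iff g_def W0 measurable_completion)
qed

theorem theorem5p1:
  fixes \<Lambda> :: "real set"
  assumes "\<Lambda> \<subseteq> {0..}"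
    and "\<not> bounded \<Lambda>"
    and "infinite \<Lambda>"
    and "discrete_set \<Lambda>"
    and "c_type2 (\<lambda>n. 1) \<Lambda>"
  shows "\<forall>c :: nat \<Rightarrow> real. (\<forall>n. 0 < c n) \<longrightarrow> c_type2 c \<Lambda>"
proof (intro allI impI)
  fix c :: "nat \<Rightarrow> real" assume c: "\<forall>n. 0 < c n"
  let ?l = "incr_enum \<Lambda>"
  have l: "strict_mono ?l" "range ?l = \<Lambda>"
    using theI'[OF strict_mono_enum_ex1[OF assms(1,3,4)]] by (auto simp: incr_enum_def)
  have fin: "finite {n. ?l n \<le> b}" for b
  proof (rule finite_imageD)
    have mem: "?l n \<in> \<Lambda>" for n using l(2) by auto
    show "finite (?l ` {n. ?l n \<le> b})"
      by (rule finite_subset[of _ "\<Lambda> \<inter> {0..b}"])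
        (use mem assms(1,4) in \<open>auto simp: discrete_set_def subset_iff\<close>)
    show "inj_on ?l {n. ?l n \<le> b}"
      using strict_mono_imp_inj_on[OF l(1)] by (rule inj_on_subset) auto
  qed
  obtain f :: "real \<Rightarrow> real" where f: "f \<in> borel_measurable lebesgue" "\<And>x. 0 \<le> f x"
    and conv: "\<not> (AE x in lebesgue. summable (\<lambda>n. f (x + ?l n)))"
    and div: "\<not> (AE x in lebesgue. \<not> summable (\<lambda>n. f (x + ?l n)))"
    using assms(5) unfolding c_type2_def mult_1 by blast
  obtain g where g: "g \<in> borel_measurable lebesgue" "\<And>x. 0 \<le> g x"
    and iff: "AE x in lebesgue. summable (\<lambda>n. c n * g (x + ?l n)) \<longleftrightarrow> summable (\<lambda>n. f (x + ?l n))"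
    using c by (auto intro: ex_weighted_AE_summable_iff[OF l(1) fin _ f, of c])
  have "(AE x in lebesgue. summable (\<lambda>n. c n * g (x + ?l n)))
      \<longleftrightarrow> (AE x in lebesgue. summable (\<lambda>n. f (x + ?l n)))"
    using iff by (rule eventually_subst)
  moreover have "(AE x in lebesgue. \<not> summable (\<lambda>n. c n * g (x + ?l n)))
      \<longleftrightarrow> (AE x in lebesgue. \<not> summable (\<lambda>n. f (x + ?l n)))"
    by (rule eventually_subst) (use iff in simp)
  ultimately show "c_type2 c \<Lambda>"
    using conv div g unfolding c_type2_def by (intro exI[of _ g]) simp
qed

end
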